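(* Let $\alpha>1$ be a real number and let $m_1,m_\alpha$ be real numbers with $m_1>0$ and $m_\alpha>m_1^\alpha$. Then the following hold. (a) The function $\Pi_{1,\alpha}(q):=\sup_{F\in\mathcal F_{1,\alpha}}\mathbb E_F[\tilde d-q]_+$, $q\ge 0$, is regularly varying at infinity with index $-(\alpha-1)$. (b) There exists a distribution function $F^*$ of a non-negative random variable, with $F^*\notin\mathcal F_{1,\alpha}$, such that for $\tilde d^*\sim F^*$, $$\mathbb E_{F^*}[\tilde d^*-q]_+=\sup_{F\in\mathcal F_{1,\alpha}}\mathbb E_F[\tilde d-q]_+\qquad\text{for all } q\ge 0.$$ Furthermore, $\overline F^*:=1-F^*$ is regularly varying at infinity with index $-\alpha$, $\mathbb E_{F^*}[(\tilde d^* )^{\alpha_1}]<\infty$ for all $0\le\alpha_1<\alpha$, and $\mathbb E_{F^*}[(\tilde d^* )^{\alpha_1}]=\infty$ for all $\alpha_1\ge\alpha$.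
   Context: $\mathcal F_{1,\alpha}$ denotes the set of all Borel probability distributions $F$ on $[0,\infty)$ (identified with their cumulative distribution functions) with $\int_0^\infty w\,dF(w)=m_1$ and $\int_0^\infty w^\alpha\,dF(w)=m_\alpha$. For $F\in\mathcal F_{1,\alpha}$, $\tilde d$ denotes a random variable with distribution $F$, and $\mathbb E_F[\tilde d-q]_+=\int_0^\infty \max(0,w-q)\,dF(w)$. A function $u:[0,\infty)\to[0,\infty)$ is regularly varying at infinity with index $\rho\in\mathbb R$ if $\lim_{x\to\infty}u(tx)/u(x)=t^{\rho}$ for all $t>0$. *)

theory Defs
  imports "HOL-Probability.Probability"
begin

text \<open>
  Distributions on \<open>[0,\<infinity>)\<close> are Borel probability measures on the real line carried by \<open>{0..}\<close>;
  the associated distribution function is the library's \<^const>\<open>cdf\<close>.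
\<close>
definition nonneg_distribution :: "real measure \<Rightarrow> bool" where
  "nonneg_distribution F \<longleftrightarrow> real_distribution F \<and> measure F {0..} = 1"

text \<open>
  All expectations below are of non-negative quantities, so they are taken as \<open>[0,\<infinity>]\<close>-valued
  integrals.  For \<open>a = 0\<close> the convention \<open>0 powr 0 = 0\<close> drops the atom at the origin
  (\<open>moment 0 F\<close> is the mass of \<open>(0,\<infinity>)\<close>), which does not affect finiteness.
\<close>
definition moment :: "real \<Rightarrow> real measure \<Rightarrow> ennreal" where
  "moment a F = (\<integral>\<^sup>+ w. ennreal (w powr a) \<partial>F)"

definition excess :: "real measure \<Rightarrow> real \<Rightarrow> ennreal" where
  "excess F q = (\<integral>\<^sup>+ w. ennreal (max 0 (w - q)) \<partial>F)"

definition moment_class :: "real \<Rightarrow> real \<Rightarrow> real \<Rightarrow> real measure set" where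
  "moment_class \<alpha> m1 m\<alpha> =
     {F. nonneg_distribution F \<and> (\<integral>\<^sup>+ w. ennreal w \<partial>F) = ennreal m1 \<and> moment \<alpha> F = ennreal m\<alpha>}"

definition worst_excess :: "real \<Rightarrow> real \<Rightarrow> real \<Rightarrow> real \<Rightarrow> ennreal" where
  "worst_excess \<alpha> m1 m\<alpha> q = (SUP F\<in>moment_class \<alpha> m1 m\<alpha>. excess F q)"

text \<open>
  A function on \<open>[0,\<infinity>)\<close> is represented by a function on the reals whose values at negative
  arguments play no role.
\<close>
definition regularly_varying :: "(real \<Rightarrow> real) \<Rightarrow> real \<Rightarrow> bool" where
  "regularly_varying u \<rho> \<longleftrightarrow>
     (\<forall>x\<ge>0. 0 \<le> u x) \<and>
     (\<forall>t>0. ((\<lambda>x. u (t * x) / u x) \<longlongrightarrow> t powr \<rho>) at_top)"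

end

theory Submission
  imports Defs "HOL-Real_Asymp.Real_Asymp"
begin

text \<open>
  Write \<open>\<Pi> q\<close> for the worst-case excess and \<open>V = m\<alpha> - m1 powr \<alpha>\<close>. Then \<open>q powr (\<alpha> - 1) * \<Pi> q\<close>
  tends to \<open>C = V * (\<alpha> - 1) powr (\<alpha> - 1) / \<alpha> powr \<alpha>\<close>, which gives (a). For the upper bound, a multiple
  of the gap \<open>h\<close> between \<open>w powr \<alpha>\<close> and its tangent at \<open>m1\<close> dominates \<open>max 0 (w - q)\<close>, and every
  admissible distribution integrates \<open>h\<close> to \<open>V\<close>; for the lower bound, take a two-point distribution
  with upper atom \<open>\<alpha> / (\<alpha> - 1) * q\<close>.

  As a supremum of convex functions \<open>\<Pi>\<close> is convex; it vanishes at infinity and equals \<open>m1 - q\<close> for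
  \<open>q \<le> 0\<close>. So one plus its right derivative is the distribution function of some \<open>F\<close> whose expected
  excess is \<open>\<Pi>\<close>. Since the tail of \<open>F\<close> is monotone, the asymptotics of \<open>\<Pi>\<close> pass to its derivative:
  \<open>q powr \<alpha> * (1 - cdf F q)\<close> tends to \<open>(\<alpha> - 1) * C > 0\<close>, and this decides which moments are finite.
\<close>

subsection \<open>Regular variation and monotone densities\<close>

text \<open>Handles functions asymptotic to a pure power: after dividing out
  \<open>x powr \<rho>\<close>, the values at \<open>t * x\<close> and at \<open>x\<close> have the
  same limit, and \<open>c > 0\<close> lets their ratio tend to 1.\<close>

lemma regularly_varyingI:
  assumes nonneg: "\<And>x. x \<ge> 0 \<Longrightarrow> 0 \<le> u x"
    and lim: "((\<lambda>x. x powr (- \<rho>) * u x) \<longlongrightarrow> c) at_top" and c: "c > 0"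
  shows "regularly_varying u \<rho>"
  unfolding regularly_varying_def
proof (intro conjI allI impI)
  fix t :: real assume t: "t > 0"
  let ?f = "\<lambda>x. x powr (- \<rho>) * u x"
  have "filterlim (\<lambda>x. t * x) at_top at_top"
    using t by (intro filterlim_tendsto_pos_mult_at_top[OF tendsto_const _ filterlim_ident])
  from filterlim_compose[OF lim this]
  have "((\<lambda>x. ?f (t * x) / ?f x) \<longlongrightarrow> c / c) at_top"
    using c by (intro tendsto_divide lim) auto
  then have "((\<lambda>x. t powr \<rho> * (?f (t * x) / ?f x)) \<longlongrightarrow> t powr \<rho> * 1) at_top"
    using c by (intro tendsto_mult) auto
  moreover have "\<forall>\<^sub>F x in at_top. t powr \<rho> * (?f (t * x) / ?f x) = u (t * x) / u x"
    using eventually_gt_at_top[of 0]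
  proof eventually_elim
    case (elim x)
    then show ?case using t
      by (simp add: powr_mult powr_minus field_simps)
  qed
  ultimately show "((\<lambda>x. u (t * x) / u x) \<longlongrightarrow> t powr \<rho>) at_top"
    by (simp add: tendsto_cong)
qed (use nonneg in auto)

text \<open>The quotient is the slope of the secant of \<open>- C * s powr (- \<beta>)\<close>
  between 1 and \<open>s\<close>, so its limit is a derivative.\<close>

lemma powr_secant_tendsto:
  fixes \<beta> C :: real
  shows "((\<lambda>s. C * (1 - s powr (- \<beta>)) / (s - 1)) \<longlongrightarrow> \<beta> * C) (at 1)"
proof -
  have "((\<lambda>s::real. - C * s powr (- \<beta>)) has_field_derivative (- C * (- \<beta> * 1 powr (- \<beta> - 1)))) (at 1)"
    by (intro DERIV_cmult has_real_derivative_powr) auto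
  then show ?thesis
    by (simp add: has_field_derivative_iff field_simps)
qed

text \<open>The argument of the monotone density theorem. \<open>Q q\<close> is compared with the
  slope of \<open>- P\<close> between \<open>q\<close> and \<open>s * q\<close>; first
  \<open>q\<close> tends to infinity with \<open>s\<close> fixed, then \<open>s\<close> is taken
  close to 1. Values \<open>s > 1\<close> give the lower bound and values \<open>s < 1\<close> the
  upper bound.\<close>

lemma monotone_density_powr:
  fixes P Q :: "real \<Rightarrow> real" and \<beta> C :: real
  assumes lower: "\<And>a b. 0 < a \<Longrightarrow> a < b \<Longrightarrow> (b - a) * Q b \<le> P a - P b"
    and upper: "\<And>a b. 0 < a \<Longrightarrow> a < b \<Longrightarrow> P a - P b \<le> (b - a) * Q a"
    and lim: "((\<lambda>q. q powr \<beta> * P q) \<longlongrightarrow> C) at_top"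
  shows "((\<lambda>q. q powr (\<beta> + 1) * Q q) \<longlongrightarrow> \<beta> * C) at_top"
proof -
  define \<phi> where "\<phi> s = C * (1 - s powr (- \<beta>)) / (s - 1)" for s :: real
  \<comment> \<open>The normalised slope of \<open>- P\<close> between \<open>q\<close> and
    \<open>s * q\<close>. For \<open>s < 1\<close> numerator and denominator both change sign, so
    one formula serves both sides of 1.\<close>
  define \<psi> where "\<psi> s q = q powr (\<beta> + 1) * (P q - P (s * q)) / ((s - 1) * q)" for s q :: real
  have \<psi>: "((\<psi> s) \<longlongrightarrow> \<phi> s) at_top" if s: "s > 0" "s \<noteq> 1" for s
  proof -
    let ?f = "\<lambda>q. q powr \<beta> * P q"
    have "filterlim (\<lambda>q. s * q) at_top at_top"
      using s by (intro filterlim_tendsto_pos_mult_at_top[OF tendsto_const _ filterlim_ident])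
    from filterlim_compose[OF lim this]
    have "((\<lambda>q. (?f q - s powr (- \<beta>) * ?f (s * q)) / (s - 1)) \<longlongrightarrow> (C - s powr (- \<beta>) * C) / (s - 1)) at_top"
      using s by (intro tendsto_intros lim) auto
    moreover have "\<forall>\<^sub>F q in at_top. (?f q - s powr (- \<beta>) * ?f (s * q)) / (s - 1) = \<psi> s q"
      using eventually_gt_at_top[of 0]
    proof eventually_elim
      case (elim q)
      then show ?case using s
        by (simp add: \<psi>_def powr_mult powr_minus powr_add field_simps)
    qed
    ultimately show ?thesis
      by (simp add: tendsto_cong \<phi>_def algebra_simps)
  qed
  have \<phi>: "(\<phi> \<longlongrightarrow> \<beta> * C) (at 1)"
    unfolding \<phi>_def by (rule powr_secant_tendsto)
  show ?thesis
  proof (rule order_tendstoI)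
    fix l assume "l < \<beta> * C"
    then have "\<forall>\<^sub>F s in at_right 1. l < \<phi> s"
      using \<phi> by (auto simp: order_tendsto_iff filterlim_at_split)
    then have "\<forall>\<^sub>F s in at_right 1. l < \<phi> s \<and> s > 1"
      by (intro eventually_conj eventually_at_right_less)
    then obtain s where s: "l < \<phi> s" "s > 1"
      using eventually_happens by fastforce
    have "\<forall>\<^sub>F q in at_top. l < \<psi> s q"
      using \<psi>[of s] s by (auto simp: order_tendsto_iff)
    then show "\<forall>\<^sub>F q in at_top. l < q powr (\<beta> + 1) * Q q"
      using eventually_gt_at_top[of 0]
    proof eventually_elim
      case (elim q)
      have "P q - P (s * q) \<le> (s * q - q) * Q q"
        using upper[of q "s * q"] s elim by simp
      then have "(P q - P (s * q)) / ((s - 1) * q) \<le> Q q"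
        using s elim by (simp add: field_simps)
      then have "q powr (\<beta> + 1) * ((P q - P (s * q)) / ((s - 1) * q)) \<le> q powr (\<beta> + 1) * Q q"
        by (intro mult_left_mono) auto
      with elim show ?case by (simp add: \<psi>_def)
    qed
  next
    fix l assume "\<beta> * C < l"
    then have "\<forall>\<^sub>F s in at_left 1. \<phi> s < l"
      using \<phi> by (auto simp: order_tendsto_iff filterlim_at_split)
    then have "\<forall>\<^sub>F s in at_left 1. \<phi> s < l \<and> s \<in> {0<..<1}"
      by (intro eventually_conj eventually_at_left_real) auto
    then obtain s where s: "\<phi> s < l" "s > 0" "s < 1"
      using eventually_happens by fastforce
    have "\<forall>\<^sub>F q in at_top. \<psi> s q < l"
      using \<psi>[of s] s by (auto simp: order_tendsto_iff)
    then show "\<forall>\<^sub>F q in at_top. q powr (\<beta> + 1) * Q q < l"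
      using eventually_gt_at_top[of 0]
    proof eventually_elim
      case (elim q)
      have "(q - s * q) * Q q \<le> P (s * q) - P q"
        using lower[of "s * q" q] s elim by simp
      then have "(1 - s) * q * Q q \<le> P (s * q) - P q"
        by (simp add: algebra_simps)
      then have "Q q \<le> (P (s * q) - P q) / ((1 - s) * q)"
        using s elim by (simp add: pos_le_divide_eq mult_ac)
      also have "\<dots> = (P q - P (s * q)) / ((s - 1) * q)"
        using s elim by (simp add: divide_simps) (simp add: algebra_simps)
      finally have "q powr (\<beta> + 1) * Q q \<le> q powr (\<beta> + 1) * ((P q - P (s * q)) / ((s - 1) * q))"
        by (intro mult_left_mono) auto
      with elim show ?case by (simp add: \<psi>_def)
    qed
  qed
qed

text \<open>Splitting the interval into \<open>n\<close> equal pieces makes the bounds telescope to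
  \<open>(b - a) * (g b - g a) / n\<close>, which tends to 0. This identifies a function from its
  increments without differentiating, even where \<open>g\<close> jumps.\<close>

lemma constant_if_increments_bounded:
  fixes D g :: "real \<Rightarrow> real"
  assumes incr: "\<And>a b. a < b \<Longrightarrow> \<bar>D b - D a\<bar> \<le> (b - a) * (g b - g a)"
  shows "D a = D b"
proof -
  have *: "D a = D b" if "a < b" for a b
  proof -
    have "\<bar>D b - D a\<bar> \<le> (b - a) * (g b - g a) / real n" if n: "n > 0" for n :: nat
    proof -
      define x where "x i = a + (b - a) * real i / real n" for i :: nat
      have x: "x (Suc i) - x i = (b - a) / real n" for i
        using n by (simp add: x_def field_simps)
      then have x_less: "x i < x (Suc i)" for i
        using \<open>a < b\<close> n by (smt (verit) divide_pos_pos of_nat_0_less_iff)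
      have ends: "x 0 = a" "x n = b"
        using n by (simp_all add: x_def)
      have "\<bar>D b - D a\<bar> = \<bar>\<Sum>i<n. D (x (Suc i)) - D (x i)\<bar>"
        using sum_lessThan_telescope[of "\<lambda>i. D (x i)" n] ends by simp
      also have "\<dots> \<le> (\<Sum>i<n. \<bar>D (x (Suc i)) - D (x i)\<bar>)"
        by (rule sum_abs)
      also have "\<dots> \<le> (\<Sum>i<n. (b - a) / real n * (g (x (Suc i)) - g (x i)))"
        using incr[OF x_less] x by (intro sum_mono) metis
      also have "\<dots> = (b - a) / real n * (g b - g a)"
        using sum_lessThan_telescope[of "\<lambda>i. g (x i)" n] ends
        by (subst sum_distrib_left[symmetric]) simp
      finally show ?thesis by (simp add: field_simps)
    qed
    then have "\<forall>\<^sub>F n in sequentially. \<bar>D b - D a\<bar> \<le> (b - a) * (g b - g a) / real n"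
      using eventually_gt_at_top[of 0] by (rule eventually_mono[rotated])
    moreover have "(\<lambda>n. (b - a) * (g b - g a) / real n) \<longlonglongrightarrow> 0"
      by (rule lim_const_over_n)
    ultimately have "\<bar>D b - D a\<bar> \<le> 0"
      using tendsto_lowerbound[OF _ _ sequentially_bot] by blast
    then show ?thesis by simp
  qed
  show ?thesis
    using *[of a b] *[of b a] by (metis linorder_less_linear)
qed

section \<open>Call spreads and tail probabilities\<close>

text \<open>The spread lies between \<open>b - a\<close> times the indicators of
  \<open>{b<..}\<close> and \<open>{a<..}\<close>. Being bounded, it is integrable before anything
  is known about the mean.\<close>

lemma (in real_distribution)
  fixes a b :: real
  assumes "a < b"
  shows integrable_call_spread: "integrable M (\<lambda>w. max 0 (w - a) - max 0 (w - b))"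
    and call_spread_ge: "(b - a) * measure M {b<..} \<le> (\<integral>w. max 0 (w - a) - max 0 (w - b) \<partial>M)"
    and call_spread_le: "(\<integral>w. max 0 (w - a) - max 0 (w - b) \<partial>M) \<le> (b - a) * measure M {a<..}"
proof -
  show int: "integrable M (\<lambda>w. max 0 (w - a) - max 0 (w - b))"
    using assms by (intro integrable_const_bound[of _ "b - a"]) auto
  have ind: "integrable M (\<lambda>w. (b - a) * indicator {c<..} w)"
    "(\<integral>w. (b - a) * indicator {c<..} w \<partial>M) = (b - a) * measure M {c<..}" for c
    by (auto intro!: integrable_mult_right integrable_real_indicator simp: emeasure_eq_measure)
  have "(\<integral>w. (b - a) * indicator {b<..} w \<partial>M) \<le> (\<integral>w. max 0 (w - a) - max 0 (w - b) \<partial>M)"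
    using assms by (intro integral_mono ind int) (auto simp: indicator_def)
  then show "(b - a) * measure M {b<..} \<le> (\<integral>w. max 0 (w - a) - max 0 (w - b) \<partial>M)"
    by (simp add: ind)
  have "(\<integral>w. max 0 (w - a) - max 0 (w - b) \<partial>M) \<le> (\<integral>w. (b - a) * indicator {a<..} w \<partial>M)"
    using assms by (intro integral_mono ind int) (auto simp: indicator_def)
  then show "(\<integral>w. max 0 (w - a) - max 0 (w - b) \<partial>M) \<le> (b - a) * measure M {a<..}"
    by (simp add: ind)
qed

lemma (in real_distribution) has_integral_excess:
  assumes "excess M q = ennreal x" "0 \<le> x"
  shows "integrable M (\<lambda>w. max 0 (w - q))" "(\<integral>w. max 0 (w - q) \<partial>M) = x"
proof -
  show int: "integrable M (\<lambda>w. max 0 (w - q))"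
    using assms by (intro integrableI_nonneg) (auto simp: excess_def)
  show "(\<integral>w. max 0 (w - q) \<partial>M) = x"
    using assms by (subst integral_eq_nn_integral) (auto simp: excess_def)
qed

text \<open>Supplies the two hypotheses of \<open>monotone_density_powr\<close>, with the tail
  probability as \<open>Q\<close>.\<close>

lemma (in real_distribution) excess_decrement:
  assumes "a < b" and ex: "\<And>q. excess M q = ennreal (P q)" and nonneg: "\<And>q. 0 \<le> P q"
  shows "(b - a) * measure M {b<..} \<le> P a - P b" "P a - P b \<le> (b - a) * measure M {a<..}"
proof -
  have "(\<integral>w. max 0 (w - a) - max 0 (w - b) \<partial>M) = P a - P b"
    using has_integral_excess[OF ex nonneg] by simp
  with call_spread_ge[OF \<open>a < b\<close>] call_spread_le[OF \<open>a < b\<close>]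
  show "(b - a) * measure M {b<..} \<le> P a - P b" "P a - P b \<le> (b - a) * measure M {a<..}"
    by auto
qed

lemma (in real_distribution) measure_greaterThan: "measure M {x<..} = 1 - cdf M x"
proof -
  have "UNIV - {..x} = {x<..}" by auto
  then show ?thesis
    using prob_compl[of "{..x}"] by (simp add: cdf_def)
qed

subsection \<open>Convex functions as expected excesses\<close>

text \<open>For convex \<open>f\<close> the secant slopes from \<open>a\<close> increase with
  \<open>b\<close>, so this infimum is the right derivative.\<close>

definition right_slope :: "(real \<Rightarrow> real) \<Rightarrow> real \<Rightarrow> real" where
  "right_slope f a = (INF b\<in>{a<..}. (f b - f a) / (b - a))"

lemma
  fixes f :: "real \<Rightarrow> real"
  assumes conv: "convex_on UNIV f" and "a < b"
  shows right_slope_le: "right_slope f a \<le> (f b - f a) / (b - a)"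
    and right_slope_ge: "(f b - f a) / (b - a) \<le> right_slope f b"
proof -
  have three: "(f t - f x) / (t - x) \<le> (f y - f t) / (y - t)" if "x < t" "t < y" for x t y
  proof -
    have "(f x - f t) / (x - t) = (f t - f x) / (t - x)" "(f t - f y) / (t - y) = (f y - f t) / (y - t)"
      using minus_divide_divide[of "f t - f x" "t - x"] minus_divide_divide[of "f y - f t" "y - t"]
      by simp_all
    then show ?thesis
      using convex_on_slope_le[OF conv _ _ that] by simp
  qed
  have "bdd_below ((\<lambda>b. (f b - f a) / (b - a)) ` {a<..})"
    using three[of "a - 1" a] by (intro bdd_belowI2[of _ "(f a - f (a - 1)) / (a - (a - 1))"]) auto
  then show "right_slope f a \<le> (f b - f a) / (b - a)"
    unfolding right_slope_def using \<open>a < b\<close> by (intro cINF_lower) auto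
  show "(f b - f a) / (b - a) \<le> right_slope f b"
    unfolding right_slope_def using three \<open>a < b\<close> by (intro cINF_greatest) auto
qed

lemma right_slope_mono:
  assumes "convex_on UNIV f" and "a \<le> b"
  shows "right_slope f a \<le> right_slope f b"
  using right_slope_le[OF assms(1), of a b] right_slope_ge[OF assms(1), of a b] assms(2)
  by (cases "a = b") auto

text \<open>Values cannot drop to the right, by monotonicity. They cannot jump up either: a secant
  from \<open>a\<close> to some \<open>c\<close> with slope below \<open>l\<close> keeps its slope
  below \<open>l\<close> when its left end moves slightly, and that slope bounds
  \<open>right_slope f x\<close>.\<close>

lemma right_slope_right_continuous:
  fixes f :: "real \<Rightarrow> real"
  assumes conv: "convex_on UNIV f"
  shows "continuous (at_right a) (right_slope f)"
  unfolding continuous_within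
proof (rule order_tendstoI)
  fix l assume "l < right_slope f a"
  then show "\<forall>\<^sub>F x in at_right a. l < right_slope f x"
    by (intro eventually_mono[OF eventually_at_right_less[of a]])
      (erule less_le_trans, rule right_slope_mono[OF conv], simp)
next
  fix l assume "right_slope f a < l"
  then have "\<exists>c>a. (f c - f a) / (c - a) < l"
    unfolding right_slope_def
    using cINF_greatest[of "{a<..}" l "\<lambda>c. (f c - f a) / (c - a)"]
    by (meson greaterThan_iff greaterThan_non_empty not_le)
  then obtain c where c: "a < c" "(f c - f a) / (c - a) < l"
    by blast
  have "isCont f a"
    using convex_on_continuous[OF open_UNIV conv] by (simp add: continuous_on_eq_continuous_at)
  then have "(f \<longlongrightarrow> f a) (at_right a)"
    unfolding isCont_def by (rule tendsto_within_subset) simp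
  then have "((\<lambda>x. (f c - f x) / (c - x)) \<longlongrightarrow> (f c - f a) / (c - a)) (at_right a)"
    using c by (intro tendsto_intros) auto
  then have "\<forall>\<^sub>F x in at_right a. (f c - f x) / (c - x) < l"
    using c(2) by (rule order_tendstoD)
  moreover have "\<forall>\<^sub>F x in at_right a. x \<in> {a<..<c}"
    using c(1) by (rule eventually_at_right_real)
  ultimately show "\<forall>\<^sub>F x in at_right a. right_slope f x < l"
  proof eventually_elim
    case (elim x)
    then show ?case
      using right_slope_le[OF conv, of x c] by simp
  qed
qed

text \<open>\<open>left\<close> forces slope -1 on the negative axis, hence no mass there;
  \<open>lim\<close> forces the slope to tend to 0, hence total mass 1.\<close>

lemma convex_imp_excess:
  fixes P :: "real \<Rightarrow> real"
  assumes conv: "convex_on UNIV P" and lim: "(P \<longlongrightarrow> 0) at_top"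
    and left: "\<And>q. q \<le> 0 \<Longrightarrow> P q = m - q"
  obtains F where "nonneg_distribution F" "\<And>q. excess F q = ennreal (P q)"
proof -
  define R where "R = right_slope P"
  have R_le: "R a \<le> (P b - P a) / (b - a)" and R_ge: "(P b - P a) / (b - a) \<le> R b" if "a < b" for a b
    unfolding R_def using right_slope_le[OF conv that] right_slope_ge[OF conv that] by auto
  have R_neg: "R q = - 1" if "q < 0" for q
    using R_le[of q 0] R_ge[of "q - 1" q] left[of 0] left[of q] left[of "q - 1"] that
    by (simp add: field_simps)
  \<comment> \<open>\<open>R q\<close> is below every secant slope from \<open>q\<close>, and the
    slope to \<open>b\<close> tends to 0 as \<open>b\<close> grows.\<close>
  have R_le0: "R q \<le> 0" for q
  proof (rule tendsto_lowerbound)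
    have "((\<lambda>b. (P b - P q) * inverse (b - q)) \<longlongrightarrow> (0 - P q) * 0) at_top"
      by (intro tendsto_intros lim tendsto_inverse_0_at_top) real_asymp
    then show "((\<lambda>b. (P b - P q) / (b - q)) \<longlongrightarrow> 0) at_top"
      by (simp add: divide_inverse)
    show "\<forall>\<^sub>F b in at_top. R q \<le> (P b - P q) / (b - q)"
      using eventually_gt_at_top[of q] by eventually_elim (rule R_le)
  qed simp
  have R_top: "(R \<longlongrightarrow> 0) at_top"
  proof (rule tendsto_sandwich)
    have "filterlim (\<lambda>b::real. b - 1) at_top at_top" by real_asymp
    from tendsto_diff[OF lim filterlim_compose[OF lim this]]
    show "((\<lambda>b. P b - P (b - 1)) \<longlongrightarrow> 0) at_top" by simp
    show "\<forall>\<^sub>F b in at_top. P b - P (b - 1) \<le> R b"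
      using R_ge[of "b - 1" b for b] by simp
  qed (use R_le0 in \<open>auto intro: tendsto_const\<close>)
  define G where "G q = 1 + R q" for q
  have G: "\<And>x y. x \<le> y \<Longrightarrow> G x \<le> G y" "\<And>a. continuous (at_right a) G"
    using right_slope_mono[OF conv] right_slope_right_continuous[OF conv]
    by (auto simp: G_def[abs_def] R_def intro!: continuous_intros)
  have G_bot: "(G \<longlongrightarrow> 0) at_bot"
    by (rule tendsto_eventually, rule eventually_mono[OF eventually_gt_at_bot[of 0]])
      (simp add: G_def R_neg)
  have G_top: "(G \<longlongrightarrow> 1) at_top"
    unfolding G_def using tendsto_add[OF tendsto_const R_top, of 1] by simp
  define F where "F = interval_measure G"
  interpret F: real_distribution F
    unfolding F_def using G G_bot G_top by (rule real_distribution_interval_measure)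
  have cdf_F: "cdf F x = 1 + R x" for x
    unfolding F_def cdf_def using measure_interval_measure_Iic[OF G G_bot] by (simp add: G_def)
  have tail: "measure F {x<..} = - R x" for x
    by (simp add: F.measure_greaterThan cdf_F)
  \<comment> \<open>This mass is the left limit of the cdf at 0; an atom at 0 itself remains
    possible.\<close>
  have "measure F {..<0} = 0"
  proof (rule tendsto_unique[OF _ F.cdf_at_left])
    show "(cdf F \<longlongrightarrow> 0) (at_left 0)"
      by (rule tendsto_eventually, rule eventually_at_leftI[of "- 1"]) (auto simp: cdf_F R_neg)
  qed simp
  moreover have "UNIV - {..<0::real} = {0..}" by auto
  ultimately have "nonneg_distribution F"
    using F.prob_compl[of "{..<0}"] by (simp add: nonneg_distribution_def F.real_distribution_axioms)
  moreover have "excess F a = ennreal (P a)" for a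
  proof -
    \<comment> \<open>The aim is \<open>T q = P a - P q\<close>, including \<open>q < a\<close>,
      where the integrand is nonpositive. Letting \<open>q\<close> tend to infinity then turns the
      spread into \<open>max 0 (w - a)\<close> and \<open>P a - P q\<close> into
      \<open>P a\<close>.\<close>
    define T where "T q = (\<integral>w. max 0 (w - a) - max 0 (w - q) \<partial>F)" for q
    have int: "integrable F (\<lambda>w. max 0 (w - x) - max 0 (w - y))" for x y
    proof (cases x y rule: linorder_cases)
      case greater
      then show ?thesis using integrable_minus[OF F.integrable_call_spread[OF greater]] by simp
    qed (use F.integrable_call_spread in auto)
    \<comment> \<open>Increments of \<open>- T\<close> and \<open>P\<close> are squeezed between the same multiples of \<open>R\<close>.\<close>
    have "\<bar>(T y + P y) - (T x + P x)\<bar> \<le> (y - x) * (R y - R x)" if "x < y" for x y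
    proof -
      have "T y - T x = (\<integral>w. max 0 (w - x) - max 0 (w - y) \<partial>F)"
        unfolding T_def using int by (subst Bochner_Integration.integral_diff[symmetric]) auto
      then have "(y - x) * (- R y) \<le> T y - T x" "T y - T x \<le> (y - x) * (- R x)"
        using F.call_spread_ge[OF that] F.call_spread_le[OF that] by (simp_all add: tail)
      moreover have "(y - x) * R x \<le> P y - P x" "P y - P x \<le> (y - x) * R y"
        using R_le[OF that] R_ge[OF that] that by (simp_all add: field_simps)
      ultimately show ?thesis by (simp add: algebra_simps abs_le_iff)
    qed
    note eq = constant_if_increments_bounded[where D = "\<lambda>q. T q + P q", OF this]
    have "T a = 0"
      by (simp add: T_def)
    then have T: "T q = P a - P q" for q
      using eq[of q a] by simp
    let ?f = "\<lambda>n w. max 0 (w - a) - max 0 (w - (a + real n))"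
    have mono: "AE w in F. mono (\<lambda>n. ?f n w)"
      by (intro always_eventually allI) (auto simp: mono_def)
    have point: "AE w in F. (\<lambda>n. ?f n w) \<longlonglongrightarrow> max 0 (w - a)"
    proof (intro AE_I2 tendsto_eventually)
      fix w :: real
      have "\<forall>\<^sub>F n in sequentially. w - a \<le> real n"
        using filterlim_real_sequentially by (simp add: filterlim_at_top)
      then show "\<forall>\<^sub>F n in sequentially. ?f n w = max 0 (w - a)"
        by eventually_elim auto
    qed
    have "filterlim (\<lambda>n. a + real n) at_top sequentially" by real_asymp
    from tendsto_diff[OF tendsto_const filterlim_compose[OF lim this], of "P a"]
    have ilim: "(\<lambda>n. integral\<^sup>L F (?f n)) \<longlonglongrightarrow> P a"
      using T by (simp add: T_def)
    have "has_bochner_integral F (\<lambda>w. max 0 (w - a)) (P a)"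
      by (rule has_bochner_integral_monotone_convergence[OF int mono point ilim]) auto
    then show ?thesis
      unfolding excess_def
      by (subst nn_integral_eq_integral) (auto simp: has_bochner_integral_iff)
  qed
  ultimately show ?thesis by (rule that)
qed

subsection \<open>Asymptotics of the worst-case excess\<close>

lemma AE_nonneg_distribution:
  assumes "nonneg_distribution F"
  shows "AE w in F. 0 \<le> w"
proof -
  interpret real_distribution F
    using assms by (simp add: nonneg_distribution_def)
  have "AE w in F. w \<in> {0..}"
    using assms by (intro AE_prob_1) (simp add: nonneg_distribution_def)
  then show ?thesis by simp
qed

text \<open>Convexity is applied on the open half-line. At \<open>w = 0\<close> the tangent has the
  value \<open>(1 - p) * y powr p\<close>, which is at most 0.\<close>

lemma powr_above_tangent:
  fixes p y w :: real
  assumes "p > 1" "y > 0" "w \<ge> 0"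
  shows "y powr p + p * y powr (p - 1) * (w - y) \<le> w powr p"
proof (cases "w = 0")
  case True
  have "y powr (p - 1) * y = y powr p"
    using assms by (simp add: powr_diff)
  moreover have "p * c * (w - y) = - p * (c * y)" for c
    using True by simp
  ultimately have "y powr p + p * y powr (p - 1) * (w - y) = (1 - p) * y powr p"
    by (simp add: left_diff_distrib)
  also have "\<dots> \<le> 0"
    using assms by (simp add: mult_nonpos_nonneg)
  finally show ?thesis using True by simp
next
  case False
  have "w powr p - y powr p \<ge> (p * y powr (p - 1)) * (w - y)"
  proof (rule convex_on_imp_above_tangent[where A = "{0<..}"])
    show "convex_on {0<..} (\<lambda>x. x powr p)"
      using assms by (intro powr_convex) simp
    show "((\<lambda>x. x powr p) has_real_derivative p * y powr (p - 1)) (at y within {0<..})"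
      using assms by (auto intro: has_field_derivative_at_within[OF has_real_derivative_powr])
  qed (use assms False in \<open>auto simp: interior_open\<close>)
  then show ?thesis by simp
qed

text \<open>
  The supremum over \<open>w > q\<close> of \<open>(w - q) / w powr p\<close> is attained at \<open>w = p / (p - 1) * q\<close> and equals
  \<open>call_const p * q powr (1 - p)\<close>.
\<close>
definition call_const :: "real \<Rightarrow> real" where
  "call_const p = 1 / (p * (p / (p - 1)) powr (p - 1))"

lemma call_const_pos: "p > 1 \<Longrightarrow> call_const p > 0"
  by (simp add: call_const_def)

lemma call_le_powr:
  fixes p q w :: real
  assumes "p > 1" "q > 0" "w \<ge> 0"
  shows "w - q \<le> call_const p * q powr (1 - p) * w powr p"
proof -
  \<comment> \<open>The tangent to \<open>w powr p\<close> at this \<open>y\<close> vanishes exactly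
    at \<open>q\<close>, because \<open>y - y / p = q\<close>. The tangent inequality thus becomes a
    bound on \<open>w - q\<close>.\<close>
  define y where "y = p / (p - 1) * q"
  have "y * (p - 1) = p * q"
    using assms by (simp add: y_def)
  then have "y - y / p = q"
    using assms(1) by (simp add: field_simps)
  moreover have "y > 0"
    using assms by (simp add: y_def)
  ultimately have y: "y > 0" "y - y / p = q" by auto
  have "y powr (p - 1) * y = y powr p"
    using y by (simp add: powr_diff)
  moreover have "p * c * (w - (y - y / p)) = c * y + p * c * (w - y)" for c
    using assms(1) by (simp add: field_simps)
  ultimately have "p * y powr (p - 1) * (w - q) = y powr p + p * y powr (p - 1) * (w - y)"
    unfolding y(2) by simp
  then have "p * y powr (p - 1) * (w - q) \<le> w powr p"
    using powr_above_tangent[of p y w] assms y(1) by simp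
  then have "w - q \<le> w powr p / (p * y powr (p - 1))"
    using assms y(1) by (simp add: pos_le_divide_eq mult.commute)
  also have "p * y powr (p - 1) = q powr (p - 1) / call_const p"
    unfolding y_def call_const_def using assms by (subst powr_mult) simp_all
  also have "w powr p / \<dots> = call_const p * q powr (1 - p) * w powr p"
    using powr_minus_divide[of q "p - 1"] by simp
  finally show ?thesis .
qed

section \<open>Lower bound from two-point distributions\<close>

text \<open>The mean fixes the weights of the atoms; \<open>mom\<close> is the remaining moment
  equation, cleared of its denominator. The excess is bounded below by the contribution of the upper
  atom.\<close>

lemma two_point_in_moment_class:
  fixes \<alpha> m1 m\<alpha> x y :: real
  assumes x: "0 \<le> x" "x < m1" and y: "m1 < y"
    and mom: "(m1 - x) * y powr \<alpha> + (y - m1) * x powr \<alpha> = m\<alpha> * (y - x)"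
  obtains F where "F \<in> moment_class \<alpha> m1 m\<alpha>"
    "\<And>q. ennreal ((m1 - x) / (y - x) * (y - q)) \<le> excess F q"
proof -
  define p where "p = (m1 - x) / (y - x)"
  have p: "0 \<le> p" "p \<le> 1"
    using x y by (simp_all add: p_def)
  define F where "F = distr (measure_pmf (bernoulli_pmf p)) borel (\<lambda>b. if b then y else x)"
  have dist: "real_distribution F"
    unfolding F_def by (intro prob_space.real_distribution_distr measure_pmf.prob_space_axioms) simp
  interpret real_distribution F by (fact dist)
  have nn: "(\<integral>\<^sup>+ w. ennreal (f w) \<partial>F) = ennreal (p * f y + (1 - p) * f x)"
    if [measurable]: "f \<in> borel_measurable borel" and f: "0 \<le> f x" "0 \<le> f y" for f :: "real \<Rightarrow> real"
  proof -
    have "(\<integral>\<^sup>+ w. ennreal (f w) \<partial>F) = (\<integral>\<^sup>+ b. ennreal (f (if b then y else x)) \<partial>measure_pmf (bernoulli_pmf p))"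
      unfolding F_def by (subst nn_integral_distr) auto
    also have "\<dots> = ennreal (f y) * ennreal p + ennreal (f x) * ennreal (1 - p)"
      using p by simp
    also have "\<dots> = ennreal (p * f y + (1 - p) * f x)"
      using p f by (simp add: ennreal_mult mult.commute)
    finally show ?thesis .
  qed
  have "emeasure F {0..} = 1"
    using x y p nn[of "indicator {0..}"] by (simp add: ennreal_indicator)
  then have nonneg: "nonneg_distribution F"
    by (simp add: nonneg_distribution_def dist emeasure_eq_measure)
  have mix: "p * a + (1 - p) * b = ((m1 - x) * a + (y - m1) * b) / (y - x)" for a b
    using x y by (simp add: p_def divide_simps)
  have "p * y + (1 - p) * x = m1" "p * y powr \<alpha> + (1 - p) * x powr \<alpha> = m\<alpha>"
    unfolding mix mom using x y by (simp_all add: divide_simps algebra_simps)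
  then have "F \<in> moment_class \<alpha> m1 m\<alpha>"
    using x y nonneg nn[of "\<lambda>w. w"] nn[of "\<lambda>w. w powr \<alpha>"]
    by (simp add: moment_class_def moment_def)
  moreover have "ennreal ((m1 - x) / (y - x) * (y - q)) \<le> excess F q" for q
  proof -
    have "p * (y - q) \<le> p * max 0 (y - q) + (1 - p) * max 0 (x - q)"
      using p by (intro order_trans[OF _ add_increasing2[OF _ order_refl]] mult_left_mono) auto
    then show ?thesis
      using nn[of "\<lambda>w. max 0 (w - q)"] by (simp add: excess_def p_def ennreal_leI)
  qed
  ultimately show ?thesis by (rule that)
qed

lemma worst_excess_ge:
  fixes \<alpha> m1 m\<alpha> :: real
  assumes \<alpha>: "\<alpha> > 1" and m1: "m1 > 0" and m\<alpha>: "m\<alpha> > m1 powr \<alpha>"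
    and y: "y > m1" "m1 * y powr (\<alpha> - 1) \<ge> m\<alpha>" and q: "q \<le> y"
  shows "ennreal ((m\<alpha> - m1 powr \<alpha>) * y powr (- \<alpha>) * (y - q)) \<le> worst_excess \<alpha> m1 m\<alpha> q"
proof -
  \<comment> \<open>The \<alpha>-moment of the distribution on \<open>{x, y}\<close> with mean
    \<open>m1\<close>. It is \<open>m1 * y powr (\<alpha> - 1)\<close> at \<open>x = 0\<close> and
    \<open>m1 powr \<alpha>\<close> at \<open>x = m1\<close>, so a suitable lower atom exists in
    between.\<close>
  define f where "f x = ((m1 - x) * y powr \<alpha> + (y - m1) * x powr \<alpha>) / (y - x)" for x
  have "\<exists>x. 0 \<le> x \<and> x \<le> m1 \<and> f x = m\<alpha>"
  proof (rule IVT2')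
    show "f m1 \<le> m\<alpha>" "m\<alpha> \<le> f 0"
      using \<alpha> m1 m\<alpha> y by (simp_all add: f_def powr_diff)
    show "continuous_on {0..m1} f"
      unfolding f_def using \<alpha> y by (intro continuous_intros continuous_on_powr') auto
  qed (use m1 in simp)
  then obtain x where x: "0 \<le> x" "x \<le> m1" "f x = m\<alpha>" by blast
  have "f m1 = m1 powr \<alpha>"
    using y by (simp add: f_def)
  with x m\<alpha> have "x < m1" by (cases "x = m1") auto
  have mom: "(m1 - x) * y powr \<alpha> + (y - m1) * x powr \<alpha> = m\<alpha> * (y - x)"
    using x y by (simp add: f_def field_simps)
  obtain F where F: "F \<in> moment_class \<alpha> m1 m\<alpha>"
    "\<And>q. ennreal ((m1 - x) / (y - x) * (y - q)) \<le> excess F q"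
    using two_point_in_moment_class[OF x(1) \<open>x < m1\<close> y(1) mom] by blast
  have "x powr \<alpha> \<le> m1 powr \<alpha>"
    using x \<alpha> by (intro powr_mono2) auto
  \<comment> \<open>The upper atom has mass \<open>(m\<alpha> - x powr \<alpha>) / (y powr \<alpha>
    - x powr \<alpha>)\<close>; this chain bounds it below by
    \<open>(m\<alpha> - m1 powr \<alpha>) / y powr \<alpha>\<close>.\<close>
  then have "(m\<alpha> - m1 powr \<alpha>) * (y - x) \<le> (m\<alpha> - x powr \<alpha>) * (y - x)"
    using x y by (intro mult_right_mono) auto
  also have "\<dots> = (m1 - x) * (y powr \<alpha> - x powr \<alpha>)"
    using mom by (simp add: algebra_simps)
  also have "\<dots> \<le> (m1 - x) * y powr \<alpha>"
    using x by (intro mult_left_mono) auto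
  finally have "(m\<alpha> - m1 powr \<alpha>) * y powr (- \<alpha>) \<le> (m1 - x) / (y - x)"
    using x y m1 by (simp add: powr_minus field_simps)
  then have "ennreal ((m\<alpha> - m1 powr \<alpha>) * y powr (- \<alpha>) * (y - q)) \<le> excess F q"
    using q by (intro order_trans[OF ennreal_leI F(2)] mult_right_mono) auto
  also have "\<dots> \<le> worst_excess \<alpha> m1 m\<alpha> q"
    unfolding worst_excess_def by (rule SUP_upper[OF F(1)])
  finally show ?thesis .
qed

lemma eventually_worst_excess_ge:
  fixes \<alpha> m1 m\<alpha> :: real
  assumes \<alpha>: "\<alpha> > 1" and m1: "m1 > 0" and m\<alpha>: "m\<alpha> > m1 powr \<alpha>"
  shows "\<forall>\<^sub>F q in at_top. ennreal ((m\<alpha> - m1 powr \<alpha>) * call_const \<alpha> * q powr (1 - \<alpha>)) \<le> worst_excess \<alpha> m1 m\<alpha> q"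
proof -
  \<comment> \<open>The atom \<open>y = r * q\<close> maximises
    \<open>(y - q) / y powr \<alpha>\<close>, so the bound carries the same constant as
    \<open>call_le_powr\<close>.\<close>
  define r where "r = \<alpha> / (\<alpha> - 1)"
  have r: "r > 1" "r - 1 = r / \<alpha>"
    using \<alpha> by (simp_all add: r_def field_simps)
  have lim: "filterlim (\<lambda>q. r * q) at_top at_top"
    using r by (intro filterlim_tendsto_pos_mult_at_top[OF tendsto_const _ filterlim_ident]) auto
  have "filterlim (\<lambda>y. m1 * y powr (\<alpha> - 1)) at_top at_top"
    using \<alpha> m1 by real_asymp
  then have "\<forall>\<^sub>F y in at_top. m1 * y powr (\<alpha> - 1) \<ge> m\<alpha>"
    by (simp add: filterlim_at_top)
  then have "\<forall>\<^sub>F y in at_top. m1 * y powr (\<alpha> - 1) \<ge> m\<alpha> \<and> y > m1"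
    using eventually_gt_at_top[of m1] by eventually_elim simp
  from eventually_compose_filterlim[OF this lim] eventually_gt_at_top[of 0]
  show ?thesis
  proof eventually_elim
    case (elim q)
    have "r * q - q = (r - 1) * q"
      by (simp add: algebra_simps)
    also have "\<dots> = r * q / \<alpha>"
      by (simp only: r(2)) simp
    finally have "(r * q) powr (- \<alpha>) * (r * q - q) = (r * q) powr (- \<alpha>) * (r * q) / \<alpha>"
      by simp
    also have "\<dots> = (r * q) powr (1 - \<alpha>) / \<alpha>"
      using r elim by (simp add: powr_diff powr_minus field_simps)
    also have "\<dots> = call_const \<alpha> * q powr (1 - \<alpha>)"
      using \<alpha> r elim by (simp add: call_const_def r_def[symmetric] powr_mult powr_diff field_simps)
    finally have "(m\<alpha> - m1 powr \<alpha>) * (r * q) powr (- \<alpha>) * (r * q - q) = 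
        (m\<alpha> - m1 powr \<alpha>) * call_const \<alpha> * q powr (1 - \<alpha>)"
      by (simp add: mult.assoc)
    moreover have "ennreal ((m\<alpha> - m1 powr \<alpha>) * (r * q) powr (- \<alpha>) * (r * q - q)) \<le> worst_excess \<alpha> m1 m\<alpha> q"
      using elim r by (intro worst_excess_ge[OF \<alpha> m1 m\<alpha>]) auto
    ultimately show ?case by (simp only:)
  qed
qed

section \<open>Upper bound from the gap above the tangent\<close>

lemma moment_classD:
  assumes F: "F \<in> moment_class \<alpha> m1 m\<alpha>" and "m1 \<ge> 0" "m\<alpha> \<ge> 0"
  shows "has_bochner_integral F (\<lambda>w. w) m1" "has_bochner_integral F (\<lambda>w. w powr \<alpha>) m\<alpha>"
proof -
  interpret real_distribution F
    using F by (simp add: moment_class_def nonneg_distribution_def)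
  show "has_bochner_integral F (\<lambda>w. w) m1" "has_bochner_integral F (\<lambda>w. w powr \<alpha>) m\<alpha>"
    using assms AE_nonneg_distribution[of F]
    by (auto intro!: has_bochner_integral_nn_integral simp: moment_class_def moment_def)
qed

text \<open>Integrating \<open>call_le_powr\<close> directly would give the constant
  \<open>m\<alpha>\<close>. Subtracting the tangent at \<open>m1\<close>, whose expectation is
  \<open>m1 powr \<alpha>\<close>, lowers it to \<open>m\<alpha> - m1 powr \<alpha>\<close>, at the
  price of a factor \<open>1 / s\<close> with \<open>s\<close> as close to 1 as desired.\<close>

lemma eventually_worst_excess_le:
  fixes \<alpha> m1 m\<alpha> :: real
  assumes \<alpha>: "\<alpha> > 1" and m1: "m1 > 0" and m\<alpha>: "m\<alpha> > m1 powr \<alpha>" and s: "0 < s" "s < 1"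
  shows "\<forall>\<^sub>F q in at_top. worst_excess \<alpha> m1 m\<alpha> q \<le> ennreal ((m\<alpha> - m1 powr \<alpha>) * call_const \<alpha> / s * q powr (1 - \<alpha>))"
proof -
  \<comment> \<open>The convex gap \<open>h\<close> has expectation \<open>m\<alpha> - m1 powr \<alpha>\<close> and \<open>h w \<sim> w powr \<alpha>\<close>.\<close>
  define h where "h w = w powr \<alpha> - (m1 powr \<alpha> + \<alpha> * m1 powr (\<alpha> - 1) * (w - m1))" for w
  have h_nonneg: "0 \<le> h w" if "0 \<le> w" for w
    using powr_above_tangent[OF \<alpha> m1 that] by (simp add: h_def)
  have "((\<lambda>w. h w / w powr \<alpha>) \<longlongrightarrow> 1) at_top"
    unfolding h_def using \<alpha> by real_asymp
  then have "\<forall>\<^sub>F w in at_top. s < h w / w powr \<alpha>"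
    using s by (auto simp: order_tendsto_iff)
  then obtain W where W: "\<And>w. w \<ge> W \<Longrightarrow> s < h w / w powr \<alpha>"
    by (auto simp: eventually_at_top_linorder)
  show ?thesis
    using eventually_ge_at_top[of W] eventually_gt_at_top[of 0]
  proof eventually_elim
    case (elim q)
    define K where "K = call_const \<alpha> * q powr (1 - \<alpha>)"
    have K: "K \<ge> 0"
      using call_const_pos[OF \<alpha>] by (simp add: K_def)
    have point: "max 0 (w - q) \<le> K / s * h w" if "w \<ge> 0" for w
    proof (cases "w \<le> q")
      case True
      then show ?thesis
        using h_nonneg[OF that] K s by simp
    next
      case False
      then have "s * w powr \<alpha> \<le> h w"
        using W[of w] elim by (simp add: field_simps)
      then have "K * (s * w powr \<alpha>) \<le> K * h w"
        using K by (rule mult_left_mono)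
      then have "K * w powr \<alpha> \<le> K / s * h w"
        using s by (simp add: field_simps)
      with call_le_powr[OF \<alpha> _ that, of q] elim False show ?thesis
        by (simp add: K_def)
    qed
    have "excess F q \<le> ennreal (K / s * (m\<alpha> - m1 powr \<alpha>))" if F: "F \<in> moment_class \<alpha> m1 m\<alpha>" for F
    proof -
      interpret real_distribution F
        using F by (simp add: moment_class_def nonneg_distribution_def)
      have nonneg: "AE w in F. 0 \<le> w"
        using F by (intro AE_nonneg_distribution) (simp add: moment_class_def)
      have "0 \<le> m\<alpha>"
        using m\<alpha> powr_ge_zero[of m1 \<alpha>] by linarith
      note mom = moment_classD[OF F less_imp_le[OF m1] this]
      define d where "d = \<alpha> * m1 powr (\<alpha> - 1)"
      define c where "c = m1 powr \<alpha> - d * m1"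
      have h: "h = (\<lambda>w. w powr \<alpha> - d * w - c)"
        by (auto simp: h_def c_def d_def algebra_simps)
      have "has_bochner_integral F h (m\<alpha> - d * m1 - c)"
        unfolding h using mom prob_space by (simp add: has_bochner_integral_iff)
      then have hbi: "has_bochner_integral F h (m\<alpha> - m1 powr \<alpha>)"
        by (simp add: c_def)
      have "excess F q \<le> (\<integral>\<^sup>+ w. ennreal (K / s * h w) \<partial>F)"
        unfolding excess_def
        by (intro nn_integral_mono_AE eventually_mono[OF nonneg] ennreal_leI point)
      also have "\<dots> = ennreal (K / s * (m\<alpha> - m1 powr \<alpha>))"
        using hbi K s
        by (subst nn_integral_eq_integral)
          (auto simp: has_bochner_integral_iff
            intro!: eventually_mono[OF nonneg] divide_nonneg_pos mult_nonneg_nonneg h_nonneg)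
      finally show ?thesis .
    qed
    then show ?case
      unfolding worst_excess_def by (intro SUP_least) (simp add: K_def mult_ac)
  qed
qed

section \<open>Finiteness, convexity and limit of the worst-case excess\<close>

lemma worst_excess_upper: "F \<in> moment_class \<alpha> m1 m\<alpha> \<Longrightarrow> excess F q \<le> worst_excess \<alpha> m1 m\<alpha> q"
  unfolding worst_excess_def by (rule SUP_upper)

lemma worst_excess_finite:
  assumes m1: "m1 > 0"
  shows "worst_excess \<alpha> m1 m\<alpha> q < \<infinity>"
proof -
  have "excess F q \<le> ennreal (m1 + \<bar>q\<bar>)" if F: "F \<in> moment_class \<alpha> m1 m\<alpha>" for F
  proof -
    interpret real_distribution F
      using F by (simp add: moment_class_def nonneg_distribution_def)
    have nonneg: "AE w in F. 0 \<le> w"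
      using F by (intro AE_nonneg_distribution) (simp add: moment_class_def)
    have "excess F q \<le> (\<integral>\<^sup>+ w. ennreal w + ennreal \<bar>q\<bar> \<partial>F)"
      unfolding excess_def using nonneg
      by (intro nn_integral_mono_AE) (auto elim!: eventually_mono simp flip: ennreal_plus intro!: ennreal_leI)
    also have "\<dots> = ennreal m1 + ennreal \<bar>q\<bar>"
      using F emeasure_space_1 by (subst nn_integral_add) (auto simp: moment_class_def)
    finally show ?thesis using m1 by simp
  qed
  then have "worst_excess \<alpha> m1 m\<alpha> q \<le> ennreal (m1 + \<bar>q\<bar>)"
    unfolding worst_excess_def by (rule SUP_least)
  then show ?thesis by (rule order_le_less_trans) simp
qed

lemma worst_excess_nonpos:
  assumes "\<alpha> > 1" and m1: "m1 > 0" and "m\<alpha> > m1 powr \<alpha>" and q: "q \<le> 0"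
  shows "worst_excess \<alpha> m1 m\<alpha> q = ennreal (m1 - q)"
proof -
  have ex: "excess F q = ennreal (m1 - q)" if F: "F \<in> moment_class \<alpha> m1 m\<alpha>" for F
  proof -
    interpret real_distribution F
      using F by (simp add: moment_class_def nonneg_distribution_def)
    have nonneg: "AE w in F. 0 \<le> w"
      using F by (intro AE_nonneg_distribution) (simp add: moment_class_def)
    have "excess F q = (\<integral>\<^sup>+ w. ennreal w + ennreal (- q) \<partial>F)"
      unfolding excess_def using nonneg q
      by (intro nn_integral_cong_AE) (auto elim!: eventually_mono simp flip: ennreal_plus)
    also have "\<dots> = ennreal m1 + ennreal (- q)"
      using F emeasure_space_1 by (subst nn_integral_add) (auto simp: moment_class_def)
    finally show ?thesis using m1 q by (simp flip: ennreal_plus)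
  qed
  \<comment> \<open>Over an empty class the supremum would be 0, against the positive lower bound
    for large arguments.\<close>
  have "moment_class \<alpha> m1 m\<alpha> \<noteq> {}"
  proof
    assume "moment_class \<alpha> m1 m\<alpha> = {}"
    then have zero: "worst_excess \<alpha> m1 m\<alpha> x = 0" for x
      by (simp add: worst_excess_def bot_ennreal)
    have "\<forall>\<^sub>F x in at_top. (m\<alpha> - m1 powr \<alpha>) * call_const \<alpha> * x powr (1 - \<alpha>) \<le> 0"
      using eventually_worst_excess_ge[OF assms(1-3)] by (simp add: zero ennreal_eq_0_iff)
    then have "\<forall>\<^sub>F x::real in at_top. False"
      using eventually_gt_at_top[of 0]
      by eventually_elim (use call_const_pos[of \<alpha>] assms in \<open>simp add: mult_le_0_iff\<close>)
    then show False by simp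
  qed
  then show ?thesis
    unfolding worst_excess_def using ex by simp
qed

lemma worst_excess_convex:
  assumes m1: "m1 > 0"
  shows "convex_on UNIV (\<lambda>q. enn2real (worst_excess \<alpha> m1 m\<alpha> q))"
proof (rule convex_onI)
  fix t x y :: real assume t: "t > 0" "t < 1"
  let ?P = "\<lambda>q. enn2real (worst_excess \<alpha> m1 m\<alpha> q)"
  have P: "worst_excess \<alpha> m1 m\<alpha> q = ennreal (?P q)" for q
    using worst_excess_finite[OF m1, of \<alpha> m\<alpha> q] by simp
  have "excess F ((1 - t) * x + t * y) \<le> ennreal ((1 - t) * ?P x + t * ?P y)" 
    if F: "F \<in> moment_class \<alpha> m1 m\<alpha>" for F
  proof -
    interpret real_distribution F
      using F by (simp add: moment_class_def nonneg_distribution_def)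
    have split: "ennreal ((1 - t) * a + t * b) = ennreal (1 - t) * ennreal a + ennreal t * ennreal b"
      if "a \<ge> 0" "b \<ge> 0" for a b
      using t that by (simp add: ennreal_mult)
    have "max 0 (w - ((1 - t) * x + t * y)) \<le> (1 - t) * max 0 (w - x) + t * max 0 (w - y)" for w
    proof -
      have "w - ((1 - t) * x + t * y) = (1 - t) * (w - x) + t * (w - y)"
        by (simp add: algebra_simps)
      also have "\<dots> \<le> (1 - t) * max 0 (w - x) + t * max 0 (w - y)"
        using t by (intro add_mono mult_left_mono) auto
      finally show ?thesis using t by simp
    qed
    then have "excess F ((1 - t) * x + t * y) \<le> 
        (\<integral>\<^sup>+ w. ennreal (1 - t) * ennreal (max 0 (w - x)) + ennreal t * ennreal (max 0 (w - y)) \<partial>F)"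
      unfolding excess_def
      by (intro nn_integral_mono) (subst split[symmetric], auto intro!: ennreal_leI simp del: ennreal_max_0)
    also have "\<dots> = ennreal (1 - t) * excess F x + ennreal t * excess F y"
      unfolding excess_def by (simp add: nn_integral_add nn_integral_cmult)
    also have "\<dots> \<le> ennreal (1 - t) * ennreal (?P x) + ennreal t * ennreal (?P y)"
      using worst_excess_upper[OF F] by (intro add_mono mult_left_mono) (simp_all flip: P)
    also have "\<dots> = ennreal ((1 - t) * ?P x + t * ?P y)"
      by (simp add: split)
    finally show ?thesis .
  qed
  then have "worst_excess \<alpha> m1 m\<alpha> ((1 - t) * x + t * y) \<le> ennreal ((1 - t) * ?P x + t * ?P y)"
    unfolding worst_excess_def by (rule SUP_least)
  then show "?P ((1 - t) *\<^sub>R x + t *\<^sub>R y) \<le> (1 - t) * ?P x + t * ?P y"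
    using t by (intro enn2real_leI) auto
qed simp

lemma worst_excess_asymp:
  assumes \<alpha>: "\<alpha> > 1" and m1: "m1 > 0" and m\<alpha>: "m\<alpha> > m1 powr \<alpha>"
  shows "((\<lambda>q. q powr (\<alpha> - 1) * enn2real (worst_excess \<alpha> m1 m\<alpha> q)) \<longlongrightarrow>
     (m\<alpha> - m1 powr \<alpha>) * call_const \<alpha>) at_top"
proof -
  let ?C = "(m\<alpha> - m1 powr \<alpha>) * call_const \<alpha>"
  let ?P = "\<lambda>q. enn2real (worst_excess \<alpha> m1 m\<alpha> q)"
  have C: "?C > 0"
    using call_const_pos[OF \<alpha>] m\<alpha> by simp
  have P: "worst_excess \<alpha> m1 m\<alpha> q = ennreal (?P q)" for q
    using worst_excess_finite[OF m1, of \<alpha> m\<alpha> q] by simp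
  have cancel: "q powr (\<alpha> - 1) * (c * q powr (1 - \<alpha>)) = c" if "q > 0" for q c :: real
    using that by (simp add: powr_diff field_simps)
  have lower: "\<forall>\<^sub>F q in at_top. ?C \<le> q powr (\<alpha> - 1) * ?P q"
    using eventually_worst_excess_ge[OF assms] eventually_gt_at_top[of 0]
  proof eventually_elim
    case (elim q)
    then have "?C * q powr (1 - \<alpha>) \<le> ?P q"
      by (subst (asm) P) simp
    then have "q powr (\<alpha> - 1) * (?C * q powr (1 - \<alpha>)) \<le> q powr (\<alpha> - 1) * ?P q"
      by (rule mult_left_mono) simp
    then show ?case
      using cancel[of q ?C] elim by simp
  qed
  show ?thesis
  proof (rule order_tendstoI)
    fix l assume "l < ?C"
    with lower show "\<forall>\<^sub>F q in at_top. l < q powr (\<alpha> - 1) * ?P q"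
      by (auto elim!: eventually_mono)
  next
    fix l assume l: "?C < l"
    then have "?C / l < 1" "0 < l"
      using C by auto
    then obtain s where s: "?C / l < s" "s < 1"
      using dense by blast
    then have "s > 0"
      using C \<open>0 < l\<close> by (meson divide_pos_pos less_trans)
    with s \<open>0 < l\<close> have "?C / s < l"
      by (simp add: field_simps)
    show "\<forall>\<^sub>F q in at_top. q powr (\<alpha> - 1) * ?P q < l"
      using eventually_worst_excess_le[OF assms \<open>s > 0\<close> \<open>s < 1\<close>] eventually_gt_at_top[of 0]
    proof eventually_elim
      case (elim q)
      then have "?P q \<le> ?C / s * q powr (1 - \<alpha>)"
        using C \<open>s > 0\<close> by (intro enn2real_leI) auto
      then have "q powr (\<alpha> - 1) * ?P q \<le> q powr (\<alpha> - 1) * (?C / s * q powr (1 - \<alpha>))"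
        by (rule mult_left_mono) simp
      also have "\<dots> = ?C / s"
        by (rule cancel) (rule elim)
      also note \<open>?C / s < l\<close>
      finally show ?case .
    qed
  qed
qed

subsection \<open>Moments and tails\<close>

text \<open>A finite moment would make the expectation of \<open>w powr a\<close> over
  \<open>{q<..}\<close> tend to 0 by dominated convergence. For \<open>q \<ge> 1\<close> it
  dominates \<open>q powr \<alpha> * measure M {q<..}\<close>, which tends to
  \<open>c > 0\<close>.\<close>

lemma (in real_distribution) moment_eq_infinity:
  assumes tail: "((\<lambda>q. q powr \<alpha> * measure M {q<..}) \<longlongrightarrow> c) at_top" and "c > 0"
    and a: "0 \<le> \<alpha>" "\<alpha> \<le> a"
  shows "moment a M = \<infinity>"
proof (rule ccontr)
  assume "moment a M \<noteq> \<infinity>"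
  then have int: "integrable M (\<lambda>w. w powr a)"
    by (intro integrableI_nonneg) (auto simp: moment_def less_top)
  have le: "q powr \<alpha> * indicator {q<..} w \<le> w powr a" if "q \<ge> 1" for q w :: real
  proof (cases "q < w")
    case True
    have "q powr \<alpha> \<le> w powr \<alpha>"
      using True that a by (intro powr_mono2) auto
    also have "\<dots> \<le> w powr a"
      using True that a by (intro powr_mono) auto
    finally show ?thesis using True by simp
  qed simp
  have ev1: "\<forall>\<^sub>F q::real in at_top. q \<ge> 1"
    by (rule eventually_ge_at_top)
  have "((\<lambda>q. \<integral>w. w powr a * indicator {q<..} w \<partial>M) \<longlongrightarrow> (\<integral>w. 0 \<partial>M)) at_top"
  proof (rule integral_dominated_convergence_at_top)
    show "integrable M (\<lambda>w. w powr a)" by (fact int)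
    show "AE w in M. ((\<lambda>q. w powr a * indicator {q<..} w) \<longlongrightarrow> 0) at_top"
    proof (intro AE_I2 tendsto_eventually)
      fix w :: real
      show "\<forall>\<^sub>F q in at_top. w powr a * indicator {q<..} w = 0"
        using eventually_ge_at_top[of w] by eventually_elim simp
    qed
  qed (auto simp: indicator_def)
  moreover have "\<forall>\<^sub>F q in at_top. q powr \<alpha> * measure M {q<..} \<le> (\<integral>w. w powr a * indicator {q<..} w \<partial>M)"
    using ev1
  proof eventually_elim
    case (elim q)
    have "q powr \<alpha> * measure M {q<..} = (\<integral>w. q powr \<alpha> * indicator {q<..} w \<partial>M)"
      by simp
    also have "\<dots> \<le> (\<integral>w. w powr a * indicator {q<..} w \<partial>M)"
    proof (rule integral_mono)
      show "integrable M (\<lambda>w. q powr \<alpha> * indicator {q<..} w)"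
        by (auto intro!: integrable_mult_right integrable_real_indicator simp: emeasure_eq_measure)
      show "integrable M (\<lambda>w. w powr a * indicator {q<..} w)"
        using int by (intro integrable_mult_indicator[where A = "{q<..}" and f = "\<lambda>w. w powr a", simplified mult.commute real_scaleR_def]) auto
      show "q powr \<alpha> * indicator {q<..} w \<le> w powr a * indicator {q<..} w" for w
        using le[OF elim, of w] by (auto simp: indicator_def)
    qed
    finally show ?case .
  qed
  ultimately have "c \<le> (\<integral>w. 0 \<partial>M)"
    using tail by (intro tendsto_le[of at_top]) auto
  with \<open>c > 0\<close> show False by simp
qed

text \<open>Dyadic decomposition: \<open>w powr a \<le> 2 powr (a (n + 1))\<close> on \<open>{2 ^ n<..2 ^ (n + 1)}\<close>.\<close>
lemma (in real_distribution) moment_finite: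
  assumes nonneg: "AE w in M. 0 \<le> w"
    and tail: "((\<lambda>q. q powr \<alpha> * measure M {q<..}) \<longlongrightarrow> c) at_top"
    and a: "0 \<le> a" "a < \<alpha>"
  shows "moment a M < \<infinity>"
proof -
  have "filterlim (\<lambda>n::nat. 2 ^ n :: real) at_top sequentially" by real_asymp
  from filterlim_compose[OF tail this]
  have "Bseq (\<lambda>n::nat. (2 ^ n) powr \<alpha> * measure M {2 ^ n<..})"
    by (intro convergent_imp_Bseq convergentI)
  then obtain K where K: "K > 0" "\<And>n::nat. (2 ^ n) powr \<alpha> * measure M {2 ^ n<..} \<le> K"
    by (auto simp: Bseq_def abs_mult)
  \<comment> \<open>Each dyadic block is enlarged to a half-line, whose mass the tail hypothesis
    controls; the points \<open>w \<le> 1\<close> are covered by the summand 1 below.\<close>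
  let ?g = "\<lambda>n w. ennreal ((2 ^ Suc n) powr a) * indicator {2 ^ n<..} (w :: real)"
  have point: "ennreal (w powr a) \<le> 1 + (\<Sum>n. ?g n w)" if "w \<ge> 0" for w
  proof (cases "w \<le> 1")
    case True
    then have "w powr a \<le> 1"
      using that a by (simp add: powr_le1)
    then have "ennreal (w powr a) \<le> 1"
      by simp
    then show ?thesis
      by (rule order_trans) simp
  next
    case False
    obtain N where "w < 2 ^ N"
      using real_arch_pow[of 2 w] by auto
    then have ex: "\<exists>k. w \<le> 2 ^ k" by (intro exI[of _ N]) simp
    define k where "k = (LEAST k. w \<le> 2 ^ k)"
    have k: "w \<le> 2 ^ k"
      unfolding k_def using ex by (rule LeastI_ex)
    with False obtain n where n: "k = Suc n"
      by (cases k) auto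
    have "2 ^ n < w"
      using not_less_Least[of n "\<lambda>k. w \<le> 2 ^ k"] n by (simp add: k_def)
    have "w powr a \<le> (2 ^ Suc n) powr a"
      using k n that a by (intro powr_mono2) auto
    then have "ennreal (w powr a) \<le> ?g n w"
      using \<open>2 ^ n < w\<close> by (simp add: ennreal_leI)
    also have "\<dots> = sum (\<lambda>n. ?g n w) {n}"
      by (simp only: sum.insert finite.emptyI empty_iff not_False_eq_True sum.empty add_0_right)
    also have "\<dots> \<le> (\<Sum>n. ?g n w)"
      by (rule sum_le_suminf) auto
    finally show ?thesis
      by (rule order_trans) simp
  qed
  \<comment> \<open>The terms are dominated by a geometric series with ratio
    \<open>2 powr (a - \<alpha>)\<close>, which is below 1 since
    \<open>a < \<alpha>\<close>.\<close>
  have term_le: "(2 ^ Suc n) powr a * measure M {2 ^ n<..} \<le> 2 powr a * K * (2 powr (a - \<alpha>)) ^ n" for n :: nat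
  proof -
    have pow: "(2 ^ n) powr x = (2 powr x) ^ n" for x :: real
      by (simp add: powr_power powr_realpow[symmetric] powr_powr mult.commute)
    have "measure M {2 ^ n<..} \<le> K * (2 ^ n) powr (- \<alpha>)"
      using K(2)[of n] by (simp add: powr_minus divide_inverse[symmetric] pos_le_divide_eq mult.commute)
    then have "(2 ^ Suc n) powr a * measure M {2 ^ n<..} \<le> (2 ^ Suc n) powr a * (K * (2 ^ n) powr (- \<alpha>))"
      by (rule mult_left_mono) simp
    also have "\<dots> = 2 powr a * K * ((2 ^ n) powr a * (2 ^ n) powr (- \<alpha>))"
      by (simp add: powr_mult)
    also have "(2 ^ n) powr a * (2 ^ n) powr (- \<alpha>) = (2 powr (a - \<alpha>)) ^ n"
      by (simp flip: powr_add pow)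
    finally show ?thesis .
  qed
  have "moment a M \<le> (\<integral>\<^sup>+ w. 1 + (\<Sum>n. ?g n w) \<partial>M)"
    unfolding moment_def by (intro nn_integral_mono_AE eventually_mono[OF nonneg] point)
  also have "\<dots> = 1 + (\<Sum>n. ennreal ((2 ^ Suc n) powr a) * emeasure M {2 ^ n<..})"
    using emeasure_space_1 by (subst nn_integral_add) (auto simp: nn_integral_suminf nn_integral_cmult)
  also have "\<dots> = 1 + (\<Sum>n. ennreal ((2 ^ Suc n) powr a * measure M {2 ^ n<..}))"
    by (simp only: emeasure_eq_measure ennreal_mult'' measure_nonneg)
  also have "\<dots> \<le> 1 + (\<Sum>n. ennreal (2 powr a * K * (2 powr (a - \<alpha>)) ^ n))"
    by (intro add_left_mono suminf_le ennreal_leI term_le) auto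
  also have "\<dots> < \<infinity>"
  proof -
    have "norm (2 powr (a - \<alpha>)) < 1"
      using a powr_less_mono[of "a - \<alpha>" 0 2] by simp
    then have "summable (\<lambda>n. 2 powr a * K * (2 powr (a - \<alpha>)) ^ n)"
      by (intro summable_mult summable_geometric)
    then have "(\<Sum>n. ennreal (2 powr a * K * (2 powr (a - \<alpha>)) ^ n)) \<noteq> top"
      using K(1) by (intro ennreal_suminf_neq_top) auto
    then show ?thesis by (simp add: less_top)
  qed
  finally show ?thesis .
qed

section \<open>The extremal distribution\<close>

theorem theorem4p3:
  fixes \<alpha> m1 m\<alpha> :: real
  assumes "\<alpha> > 1" and "m1 > 0" and "m\<alpha> > m1 powr \<alpha>"
  shows "(\<forall>q\<ge>0. worst_excess \<alpha> m1 m\<alpha> q < \<infinity>) \<and>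
         regularly_varying (\<lambda>q. enn2real (worst_excess \<alpha> m1 m\<alpha> q)) (- (\<alpha> - 1)) \<and>
         (\<exists>F. nonneg_distribution F \<and> F \<notin> moment_class \<alpha> m1 m\<alpha> \<and>
              (\<forall>q\<ge>0. excess F q = worst_excess \<alpha> m1 m\<alpha> q) \<and>
              regularly_varying (\<lambda>x. 1 - cdf F x) (- \<alpha>) \<and>
              (\<forall>\<alpha>1. 0 \<le> \<alpha>1 \<and> \<alpha>1 < \<alpha> \<longrightarrow> moment \<alpha>1 F < \<infinity>) \<and>
              (\<forall>\<alpha>1\<ge>\<alpha>. moment \<alpha>1 F = \<infinity>))"
proof -
  define P where "P q = enn2real (worst_excess \<alpha> m1 m\<alpha> q)" for q
  define C where "C = (m\<alpha> - m1 powr \<alpha>) * call_const \<alpha>"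
  have P: "worst_excess \<alpha> m1 m\<alpha> q = ennreal (P q)" "0 \<le> P q" for q
    using worst_excess_finite[OF assms(2), of \<alpha> m\<alpha> q] by (simp_all add: P_def)
  have C: "C > 0"
    using call_const_pos assms by (simp add: C_def)
  have asymp: "((\<lambda>q. q powr (\<alpha> - 1) * P q) \<longlongrightarrow> C) at_top"
    using worst_excess_asymp[OF assms] by (simp add: P_def C_def)
  have P_top: "(P \<longlongrightarrow> 0) at_top"
  proof -
    have "((\<lambda>q::real. q powr (1 - \<alpha>)) \<longlongrightarrow> 0) at_top"
      using assms(1) by real_asymp
    from tendsto_mult[OF this asymp]
    have "((\<lambda>q. q powr (1 - \<alpha>) * (q powr (\<alpha> - 1) * P q)) \<longlongrightarrow> 0) at_top"
      by simp
    moreover have "\<forall>\<^sub>F q in at_top. q powr (1 - \<alpha>) * (q powr (\<alpha> - 1) * P q) = P q"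
      using eventually_gt_at_top[of 0] by eventually_elim (simp flip: mult.assoc powr_add)
    ultimately show ?thesis
      by (simp add: tendsto_cong)
  qed
  have conv: "convex_on UNIV P"
    unfolding P_def using assms(2) by (rule worst_excess_convex)
  have left: "P q = m1 - q" if "q \<le> 0" for q
    using worst_excess_nonpos[OF assms that] assms(2) that by (simp add: P_def)
  obtain F where F: "nonneg_distribution F" "\<And>q. excess F q = ennreal (P q)"
    using convex_imp_excess[OF conv P_top left] by blast
  interpret real_distribution F
    using F(1) by (simp add: nonneg_distribution_def)
  \<comment> \<open>The monotone density argument with exponent \<open>\<alpha> - 1\<close>: the
    tail of \<open>F\<close> is the monotone function controlling the decrements of
    \<open>P\<close>.\<close>
  have "((\<lambda>q. q powr (\<alpha> - 1 + 1) * measure F {q<..}) \<longlongrightarrow> (\<alpha> - 1) * C) at_top"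
    using excess_decrement[OF _ F(2) P(2)] by (intro monotone_density_powr[OF _ _ asymp]) auto
  then have tail: "((\<lambda>q. q powr \<alpha> * measure F {q<..}) \<longlongrightarrow> (\<alpha> - 1) * C) at_top"
    by simp
  have pos: "(\<alpha> - 1) * C > 0"
    using C assms(1) by simp
  have inf: "moment a F = \<infinity>" if "a \<ge> \<alpha>" for a
    using moment_eq_infinity[OF tail pos _ that] assms(1) by simp
  have "regularly_varying P (- (\<alpha> - 1))"
    using asymp C P(2) by (intro regularly_varyingI[of _ _ C]) auto
  moreover have "regularly_varying (\<lambda>x. 1 - cdf F x) (- \<alpha>)"
    using tail pos by (intro regularly_varyingI[of _ _ "(\<alpha> - 1) * C"]) (auto simp: measure_greaterThan cdf_bounded_prob)
  \<comment> \<open>Members of the class have the finite \<alpha>-moment \<open>m\<alpha>\<close>,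
    whereas that of \<open>F\<close> is infinite.\<close>
  moreover have "F \<notin> moment_class \<alpha> m1 m\<alpha>"
    using inf[of \<alpha>] by (auto simp: moment_class_def)
  moreover have "moment a F < \<infinity>" if "0 \<le> a" "a < \<alpha>" for a
    using moment_finite[OF AE_nonneg_distribution[OF F(1)] tail that] .
  ultimately show ?thesis
    using F inf P by (intro conjI exI[of _ F]) auto
qed

end
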